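(* Let $G=(V,E)$ be a graph, let $\varepsilon\in(0,1)$, and let $x_1,\dots,x_k\in\mathcal{P}_\varepsilon(G)$. For all $v\in V$ let $\hat y[v]=\min\{x_1[v],\dots,x_k[v]\}$, suppose $\hat y\ne\mathbf{0}$, and let $y=\hat y/\|\hat y\|_1$. Then $y\in\mathcal{P}_\varepsilon(G)$.
   Context: Graphs are finite directed graphs; vertices with no out-edges carry a self-loop. A ranking (reset) vector is $x:V\to[0,1]$ with $\sum_v x[v]=1$. $\mathrm{PR}(G,r,\varepsilon)$ is the unique stationary distribution of the chain with transition matrix $(1-\varepsilon)M+\varepsilon R$, where $M[u,v]=1/d_{out}(u)$ for $(u,v)\in E$ (else $0$) and $R[u,v]=r[v]$. $\mathcal{P}_\varepsilon(G)=\{\mathrm{PR}(G,r,\varepsilon): r\text{ a ranking vector on }G\}$. *)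

theory Defs
  imports Complex_Main "HOL-Library.FuncSet" "Graph_Theory.Pair_Digraph"
begin

text \<open>
  Loops are allowed and there are no parallel arcs. The convention that a vertex without
  out-edges carries a self-loop amounts to every vertex having an out-edge.
\<close>

locale pagerank_graph = pair_fin_digraph G for G :: "'a pair_pre_digraph" +
  assumes out_degree_pos: "u \<in> pverts G \<Longrightarrow> out_degree (with_proj G) u > 0"

text \<open>
  A vector indexed by the vertex set \<open>V\<close> is a function that is \<open>undefined\<close> outside \<open>V\<close>,
  so that equality of vectors is equality on \<open>V\<close>.
\<close>

definition ranking_vector :: "'a set \<Rightarrow> ('a \<Rightarrow> real) \<Rightarrow> bool" where
  "ranking_vector V x \<longleftrightarrow> x \<in> V \<rightarrow>\<^sub>E {0..1} \<and> (\<Sum>v\<in>V. x v) = 1"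

definition walk_matrix :: "'a pair_pre_digraph \<Rightarrow> 'a \<Rightarrow> 'a \<Rightarrow> real" where
  "walk_matrix G u v = (if (u, v) \<in> parcs G then 1 / real (out_degree (with_proj G) u) else 0)"

definition reset_matrix :: "('a \<Rightarrow> real) \<Rightarrow> 'a \<Rightarrow> 'a \<Rightarrow> real" where
  "reset_matrix r u v = r v"

definition pagerank_matrix ::
  "'a pair_pre_digraph \<Rightarrow> ('a \<Rightarrow> real) \<Rightarrow> real \<Rightarrow> 'a \<Rightarrow> 'a \<Rightarrow> real" where
  "pagerank_matrix G r \<epsilon> u v = (1 - \<epsilon>) * walk_matrix G u v + \<epsilon> * reset_matrix r u v"

definition stationary_distribution ::
  "'a set \<Rightarrow> ('a \<Rightarrow> 'a \<Rightarrow> real) \<Rightarrow> ('a \<Rightarrow> real) \<Rightarrow> bool" where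
  "stationary_distribution V P x \<longleftrightarrow>
     ranking_vector V x \<and> (\<forall>v\<in>V. (\<Sum>u\<in>V. x u * P u v) = x v)"

definition PR :: "'a pair_pre_digraph \<Rightarrow> ('a \<Rightarrow> real) \<Rightarrow> real \<Rightarrow> 'a \<Rightarrow> real" where
  "PR G r \<epsilon> = (THE x. stationary_distribution (pverts G) (pagerank_matrix G r \<epsilon>) x)"

definition pagerank_vectors :: "real \<Rightarrow> 'a pair_pre_digraph \<Rightarrow> ('a \<Rightarrow> real) set" where
  "pagerank_vectors \<epsilon> G = {PR G r \<epsilon> | r. ranking_vector (pverts G) r}"

definition l1_norm :: "'a set \<Rightarrow> ('a \<Rightarrow> real) \<Rightarrow> real" where
  "l1_norm V x = (\<Sum>v\<in>V. \<bar>x v\<bar>)"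

end

theory Submission
  imports Defs
begin

text \<open>
  For fixed \<open>\<epsilon>\<close>, the equation \<open>x = (1 - \<epsilon>) x M + \<epsilon> r\<close> can be solved for \<open>r\<close> given \<open>x\<close>: the sum of
  the entries of \<open>r\<close> is then automatically 1, so a ranking vector \<open>x\<close> is a PageRank vector iff
  that \<open>r\<close> is nonnegative, i.e. iff \<open>(1 - \<epsilon>) x M \<le> x\<close> entrywise. As \<open>M\<close> is nonnegative, this
  system of inequalities is preserved by pointwise minima and by positive scaling.
\<close>

section \<open>Fixed-point equations over a stochastic matrix\<close>

locale stochastic_matrix =
  fixes V :: "'a set" and M :: "'a \<Rightarrow> 'a \<Rightarrow> real"
  assumes finite_V: "finite V"
    and nonneg: "0 \<le> M u v"
    and row_sum: "u \<in> V \<Longrightarrow> (\<Sum>v\<in>V. M u v) = 1"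
begin

text \<open>Exchanging the sums leaves row sums of \<open>M\<close>, all equal to 1. No sign
  condition on \<open>x\<close> enters: a step of the walk preserves total mass.\<close>

lemma sum_step: "(\<Sum>v\<in>V. \<Sum>u\<in>V. x u * M u v) = (\<Sum>u\<in>V. x u)"
proof -
  have "(\<Sum>v\<in>V. \<Sum>u\<in>V. x u * M u v) = (\<Sum>u\<in>V. x u * (\<Sum>v\<in>V. M u v))"
    by (subst sum.swap) (simp add: sum_distrib_left)
  then show ?thesis
    by (simp add: row_sum)
qed

text \<open>By the triangle inequality and \<open>sum_step\<close>, \<open>M\<close> does not
  increase the l1 norm, so the norm of \<open>d\<close> is at most 1 - \<epsilon> times itself. For
  the difference of two stationary distributions this yields uniqueness.\<close>

lemma contraction_fixpoint_zero:
  assumes "0 < \<epsilon>" "\<epsilon> < 1"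
    and d: "\<And>v. v \<in> V \<Longrightarrow> d v = (1 - \<epsilon>) * (\<Sum>u\<in>V. d u * M u v)"
    and "v \<in> V"
  shows "d v = 0"
proof -
  have "(\<Sum>v\<in>V. \<bar>d v\<bar>) \<le> (\<Sum>v\<in>V. (1 - \<epsilon>) * (\<Sum>u\<in>V. \<bar>d u\<bar> * M u v))"
  proof (rule sum_mono)
    fix v assume "v \<in> V"
    then have "\<bar>d v\<bar> = (1 - \<epsilon>) * \<bar>\<Sum>u\<in>V. d u * M u v\<bar>"
      using d[of v] assms(2) by (simp add: abs_mult)
    also have "\<dots> \<le> (1 - \<epsilon>) * (\<Sum>u\<in>V. \<bar>d u * M u v\<bar>)"
      using assms(2) by (intro mult_left_mono sum_abs) simp
    finally show "\<bar>d v\<bar> \<le> (1 - \<epsilon>) * (\<Sum>u\<in>V. \<bar>d u\<bar> * M u v)"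
      by (simp add: abs_mult nonneg)
  qed
  also have "\<dots> = (1 - \<epsilon>) * (\<Sum>v\<in>V. \<bar>d v\<bar>)"
    by (simp add: sum_distrib_left[symmetric] sum_step)
  finally have "\<epsilon> * (\<Sum>v\<in>V. \<bar>d v\<bar>) \<le> 0"
    by (simp add: algebra_simps)
  then have "(\<Sum>v\<in>V. \<bar>d v\<bar>) \<le> 0"
    using assms(1) by (simp add: mult_le_0_iff)
  then have "(\<Sum>v\<in>V. \<bar>d v\<bar>) = 0"
    by (simp add: order.antisym sum_nonneg)
  then show ?thesis
    using finite_V assms(4) by (simp add: sum_nonneg_eq_0_iff)
qed

text \<open>The row vector \<open>r M^n\<close>, built by recursion because matrices are plain
  functions here.\<close>

primrec walk_distribution :: "('a \<Rightarrow> real) \<Rightarrow> nat \<Rightarrow> 'a \<Rightarrow> real" where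
  "walk_distribution r 0 = r"
| "walk_distribution r (Suc n) = (\<lambda>v. \<Sum>u\<in>V. walk_distribution r n u * M u v)"

lemma sum_walk_distribution: "(\<Sum>v\<in>V. walk_distribution r n v) = (\<Sum>v\<in>V. r v)"
  by (induction n) (simp_all add: sum_step)

lemma walk_distribution_nonneg:
  assumes "\<And>v. v \<in> V \<Longrightarrow> 0 \<le> r v" "v \<in> V"
  shows "0 \<le> walk_distribution r n v"
  using assms(2) by (induction n arbitrary: v) (auto intro!: sum_nonneg simp: assms(1) nonneg)

text \<open>The solution is the Neumann series \<open>\<Sum>n. \<epsilon> (1 - \<epsilon>)\<^sup>n r M\<^sup>n\<close>.\<close>

lemma contraction_solution_exists:
  assumes "0 < \<epsilon>" "\<epsilon> < 1" and r: "\<And>v. v \<in> V \<Longrightarrow> 0 \<le> r v"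
  obtains x where "\<And>v. v \<in> V \<Longrightarrow> 0 \<le> x v"
    "\<And>v. v \<in> V \<Longrightarrow> x v = (1 - \<epsilon>) * (\<Sum>u\<in>V. x u * M u v) + \<epsilon> * r v"
proof -
  define f where "f v n = \<epsilon> * (1 - \<epsilon>) ^ n * walk_distribution r n v" for v n
  define x where "x v = (\<Sum>n. f v n)" for v
  have f_nonneg: "0 \<le> f v n" if "v \<in> V" for v n
    using assms walk_distribution_nonneg[OF r that] by (simp add: f_def)
  have summable_f: "summable (f v)" if "v \<in> V" for v
  proof (rule summable_comparison_test')
    show "summable (\<lambda>n. \<epsilon> * (\<Sum>v\<in>V. r v) * (1 - \<epsilon>) ^ n)"
      using assms by (intro summable_mult summable_geometric) simp
    fix n
    \<comment> \<open>A nonnegative entry is at most the total mass, which the walk preserves; hence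
      a geometric series dominates.\<close>
    have "walk_distribution r n v \<le> (\<Sum>v\<in>V. r v)"
      using member_le_sum[OF that, of "walk_distribution r n"] finite_V
        walk_distribution_nonneg[OF r] by (simp add: sum_walk_distribution)
    then have "f v n \<le> \<epsilon> * (1 - \<epsilon>) ^ n * (\<Sum>v\<in>V. r v)"
      unfolding f_def using assms by (intro mult_left_mono) simp_all
    then show "norm (f v n) \<le> \<epsilon> * (\<Sum>v\<in>V. r v) * (1 - \<epsilon>) ^ n"
      using f_nonneg[OF that] by (simp add: mult_ac)
  qed
  have "x v = (1 - \<epsilon>) * (\<Sum>u\<in>V. x u * M u v) + \<epsilon> * r v" if "v \<in> V" for v
  proof -
    \<comment> \<open>Shifting the index pulls out one factor 1 - \<epsilon> and one application of
      \<open>M\<close>, so the series without its first term is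
      \<open>(1 - \<epsilon>) x M\<close>.\<close>
    have "(\<Sum>n. f v (Suc n)) = (\<Sum>n. (1 - \<epsilon>) * (\<Sum>u\<in>V. f u n * M u v))"
      by (simp add: f_def sum_distrib_left mult_ac)
    also have "\<dots> = (1 - \<epsilon>) * (\<Sum>u\<in>V. x u * M u v)"
      using summable_f by (simp add: x_def suminf_mult suminf_mult2 suminf_sum
          summable_mult2 summable_sum)
    finally have "(\<Sum>n. f v (Suc n)) = (1 - \<epsilon>) * (\<Sum>u\<in>V. x u * M u v)" .
    moreover have "f v 0 = \<epsilon> * r v"
      by (simp add: f_def)
    ultimately show ?thesis
      using suminf_split_head[OF summable_f[OF that]] by (simp add: x_def)
  qed
  moreover have "0 \<le> x v" if "v \<in> V" for v
    unfolding x_def using summable_f f_nonneg that by (intro suminf_nonneg)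
  ultimately show thesis
    using that by blast
qed

end

section \<open>PageRank vectors of a graph\<close>

text \<open>Nonnegative entries with sum 1 are at most 1, so the upper bound never has to be checked
  separately.\<close>

lemma ranking_vector_iff_nonneg:
  assumes "finite V"
  shows "ranking_vector V x \<longleftrightarrow> x \<in> extensional V \<and> (\<forall>v\<in>V. 0 \<le> x v) \<and> (\<Sum>v\<in>V. x v) = 1"
  using assms member_le_sum[of _ V x]
  by (fastforce simp: ranking_vector_def PiE_iff)

lemma walk_matrix_stochastic:
  assumes "pagerank_graph G"
  shows "stochastic_matrix (pverts G) (walk_matrix G)"
proof -
  interpret pagerank_graph G by fact
  show ?thesis
  proof
    show "finite (pverts G)"
      by simp
    show "0 \<le> walk_matrix G u v" for u v
      by (simp add: walk_matrix_def)
    fix u assume u: "u \<in> pverts G"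
    \<comment> \<open>The row sum runs over heads while the out-degree counts arcs; arcs from
      \<open>u\<close> are determined by their heads.\<close>
    have "{v \<in> pverts G. (u, v) \<in> parcs G} = snd ` out_arcs (with_proj G) u"
      by (force simp: out_arcs_def dest: in_arcsD2)
    moreover have "inj_on snd (out_arcs (with_proj G) u)"
      by (auto simp: inj_on_def out_arcs_def)
    ultimately have "card {v \<in> pverts G. (u, v) \<in> parcs G} = out_degree (with_proj G) u"
      by (simp add: card_image out_degree_def)
    then show "(\<Sum>v\<in>pverts G. walk_matrix G u v) = 1"
      using out_degree_pos[OF u] by (simp add: walk_matrix_def sum.If_cases Int_def)
  qed
qed

text \<open>The reset part contributes \<epsilon> \<open>r v\<close> times the mass of
  \<open>x\<close>, which is 1 for a ranking vector, so the equation becomes affine in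
  \<open>x\<close>.\<close>

lemma stationary_pagerank_matrix_iff:
  "stationary_distribution V (pagerank_matrix G r \<epsilon>) x \<longleftrightarrow> ranking_vector V x \<and>
    (\<forall>v\<in>V. x v = (1 - \<epsilon>) * (\<Sum>u\<in>V. x u * walk_matrix G u v) + \<epsilon> * r v)"
proof -
  have "(\<Sum>u\<in>V. x u * pagerank_matrix G r \<epsilon> u v) =
      (1 - \<epsilon>) * (\<Sum>u\<in>V. x u * walk_matrix G u v) + \<epsilon> * r v * (\<Sum>u\<in>V. x u)" for v
    by (simp add: pagerank_matrix_def reset_matrix_def distrib_left sum.distrib
        sum_distrib_left mult_ac)
  then show ?thesis
    by (auto simp: stationary_distribution_def ranking_vector_def)
qed

text \<open>This makes the definite description in \<open>PR\<close> meaningful: the Neumann series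
  gives existence, the contraction uniqueness.\<close>

lemma ex1_stationary_pagerank_matrix:
  assumes "pagerank_graph G" "0 < \<epsilon>" "\<epsilon> < 1" and r: "ranking_vector (pverts G) r"
  shows "\<exists>!x. stationary_distribution (pverts G) (pagerank_matrix G r \<epsilon>) x"
proof -
  let ?V = "pverts G" and ?M = "walk_matrix G"
  interpret stochastic_matrix ?V ?M
    using assms(1) by (rule walk_matrix_stochastic)
  note rv = ranking_vector_iff_nonneg[OF finite_V]
  obtain x where x_nonneg: "\<And>v. v \<in> ?V \<Longrightarrow> 0 \<le> x v"
    and x: "\<And>v. v \<in> ?V \<Longrightarrow> x v = (1 - \<epsilon>) * (\<Sum>u\<in>?V. x u * ?M u v) + \<epsilon> * r v"
    using contraction_solution_exists[OF assms(2,3), of r] r by (auto simp: rv)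
  \<comment> \<open>Summing the equation over all vertices gives s = (1 - \<epsilon>) s + \<epsilon>
    for the mass s, which forces s = 1.\<close>
  have "(\<Sum>v\<in>?V. x v) = (\<Sum>v\<in>?V. (1 - \<epsilon>) * (\<Sum>u\<in>?V. x u * ?M u v) + \<epsilon> * r v)"
    by (rule sum.cong[OF refl x])
  also have "\<dots> = (1 - \<epsilon>) * (\<Sum>v\<in>?V. x v) + \<epsilon>"
    using r by (simp add: sum.distrib sum_distrib_left[symmetric] sum_step rv)
  finally have "\<epsilon> * (\<Sum>v\<in>?V. x v) = \<epsilon>"
    by (simp add: algebra_simps)
  then have "(\<Sum>v\<in>?V. x v) = 1"
    using assms(2) by simp
  \<comment> \<open>The equation says nothing about values outside the vertex set, where a ranking
    vector must be \<open>undefined\<close>.\<close>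
  then have "stationary_distribution ?V (pagerank_matrix G r \<epsilon>) (restrict x ?V)"
    using x_nonneg by (simp add: stationary_pagerank_matrix_iff rv x[symmetric])
  moreover have "z = w" if "stationary_distribution ?V (pagerank_matrix G r \<epsilon>) z"
    "stationary_distribution ?V (pagerank_matrix G r \<epsilon>) w" for z w
  proof (rule extensionalityI)
    show "z \<in> extensional ?V" "w \<in> extensional ?V"
      using that by (simp_all add: stationary_pagerank_matrix_iff rv)
    fix v assume v: "v \<in> ?V"
    \<comment> \<open>The reset terms cancel, leaving the homogeneous equation.\<close>
    have "z v - w v = (1 - \<epsilon>) * (\<Sum>u\<in>?V. (z u - w u) * ?M u v)" if "v \<in> ?V" for v
    proof -
      have "z v = (1 - \<epsilon>) * (\<Sum>u\<in>?V. z u * ?M u v) + \<epsilon> * r v"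
        and "w v = (1 - \<epsilon>) * (\<Sum>u\<in>?V. w u * ?M u v) + \<epsilon> * r v"
        using \<open>stationary_distribution ?V _ z\<close> \<open>stationary_distribution ?V _ w\<close> that
        unfolding stationary_pagerank_matrix_iff by blast+
      then show ?thesis
        by (simp add: left_diff_distrib sum_subtractf right_diff_distrib)
    qed
    from contraction_fixpoint_zero[OF assms(2,3) this v] show "z v = w v"
      by simp
  qed
  ultimately show ?thesis
    by blast
qed

lemma pagerank_vectors_iff:
  assumes "pagerank_graph G" "0 < \<epsilon>" "\<epsilon> < 1"
  shows "x \<in> pagerank_vectors \<epsilon> G \<longleftrightarrow> ranking_vector (pverts G) x \<and>
    (\<forall>v\<in>pverts G. (1 - \<epsilon>) * (\<Sum>u\<in>pverts G. x u * walk_matrix G u v) \<le> x v)"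
    (is "_ \<longleftrightarrow> _ \<and> (\<forall>v\<in>?V. ?s v \<le> x v)")
proof -
  interpret stochastic_matrix ?V "walk_matrix G"
    using assms(1) by (rule walk_matrix_stochastic)
  note rv = ranking_vector_iff_nonneg[OF finite_V]
  show ?thesis
  proof
    assume "x \<in> pagerank_vectors \<epsilon> G"
    then obtain r where r: "ranking_vector ?V r" and x: "x = PR G r \<epsilon>"
      by (auto simp: pagerank_vectors_def)
    have "stationary_distribution ?V (pagerank_matrix G r \<epsilon>) x"
      unfolding x PR_def by (rule theI'[OF ex1_stationary_pagerank_matrix[OF assms r]])
    then have "ranking_vector ?V x" and "\<forall>v\<in>?V. x v = ?s v + \<epsilon> * r v"
      unfolding stationary_pagerank_matrix_iff by blast+
    moreover have "0 \<le> \<epsilon> * r v" if "v \<in> ?V" for v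
      using r assms(2) that by (simp add: rv)
    ultimately show "ranking_vector ?V x \<and> (\<forall>v\<in>?V. ?s v \<le> x v)"
      by (metis add_increasing2 order.refl)
  next
    assume x: "ranking_vector ?V x \<and> (\<forall>v\<in>?V. ?s v \<le> x v)"
    \<comment> \<open>The reset vector solved from the equation. Its numerators are nonnegative by
      assumption and add up to 1 - (1 - \<epsilon>) = \<epsilon>.\<close>
    define r where "r = (\<lambda>v\<in>?V. (x v - ?s v) / \<epsilon>)"
    have "(\<Sum>v\<in>?V. x v - ?s v) = \<epsilon>"
      using x by (simp add: sum_subtractf sum_distrib_left[symmetric] sum_step rv)
    then have r: "ranking_vector ?V r"
      using x assms(2) by (simp add: rv r_def sum_divide_distrib[symmetric])
    have "stationary_distribution ?V (pagerank_matrix G r \<epsilon>) x"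
      using x assms(2) by (simp add: stationary_pagerank_matrix_iff r_def)
    then have "PR G r \<epsilon> = x"
      unfolding PR_def by (rule the1_equality[OF ex1_stationary_pagerank_matrix[OF assms r]])
    with r show "x \<in> pagerank_vectors \<epsilon> G"
      by (auto simp: pagerank_vectors_def)
  qed
qed

theorem theorem18:
  fixes G :: "'a pair_pre_digraph" and \<epsilon> :: real and k :: nat
    and x :: "nat \<Rightarrow> 'a \<Rightarrow> real" and y_hat y :: "'a \<Rightarrow> real"
  assumes "pagerank_graph G"
    and "0 < \<epsilon>" and "\<epsilon> < 1"
    and "1 \<le> k"
    and "\<And>i. i \<in> {1..k} \<Longrightarrow> x i \<in> pagerank_vectors \<epsilon> G"
    and "y_hat = (\<lambda>v\<in>pverts G. Min ((\<lambda>i. x i v) ` {1..k}))"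
    and "y_hat \<noteq> (\<lambda>v\<in>pverts G. 0)"
    and "y = (\<lambda>v\<in>pverts G. y_hat v / l1_norm (pverts G) y_hat)"
  shows "y \<in> pagerank_vectors \<epsilon> G"
proof -
  let ?V = "pverts G" and ?M = "walk_matrix G"
  interpret stochastic_matrix ?V ?M
    using assms(1) by (rule walk_matrix_stochastic)
  note rv = ranking_vector_iff_nonneg[OF finite_V]
  note pv = pagerank_vectors_iff[OF assms(1-3)]
  have y_hat_le: "y_hat v \<le> x i v" if "v \<in> ?V" "i \<in> {1..k}" for v i
    using that by (simp add: assms(6))
  \<comment> \<open>Here \<open>1 \<le> k\<close> ensures that the minimum is over a nonempty
    set.\<close>
  have le_y_hat: "a \<le> y_hat v" if "v \<in> ?V" "\<And>i. i \<in> {1..k} \<Longrightarrow> a \<le> x i v" for v a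
    using that assms(4) by (simp add: assms(6))
  have nonneg_y_hat: "0 \<le> y_hat v" if "v \<in> ?V" for v
    using that assms(5) by (intro le_y_hat) (simp_all add: pv rv)
  \<comment> \<open>It suffices to bound the left side by each \<open>x i v\<close>: replacing
    \<open>y_hat\<close> by the larger \<open>x i\<close> only increases it, since \<open>M\<close>
    is nonnegative.\<close>
  have sub: "(1 - \<epsilon>) * (\<Sum>u\<in>?V. y_hat u * ?M u v) \<le> y_hat v" if v: "v \<in> ?V" for v
  proof (rule le_y_hat[OF v])
    fix i assume i: "i \<in> {1..k}"
    have "(1 - \<epsilon>) * (\<Sum>u\<in>?V. y_hat u * ?M u v) \<le> (1 - \<epsilon>) * (\<Sum>u\<in>?V. x i u * ?M u v)"
      using assms(3) i by (intro mult_left_mono sum_mono mult_right_mono y_hat_le nonneg) simp_all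
    also have "\<dots> \<le> x i v"
      using assms(5)[OF i] v by (simp add: pv)
    finally show "(1 - \<epsilon>) * (\<Sum>u\<in>?V. y_hat u * ?M u v) \<le> x i v" .
  qed
  define N where "N = (\<Sum>v\<in>?V. y_hat v)"
  have norm: "l1_norm ?V y_hat = N"
    by (simp add: l1_norm_def N_def nonneg_y_hat)
  have "N \<noteq> 0"
  proof
    assume "N = 0"
    then have "\<forall>v\<in>?V. y_hat v = 0"
      by (simp add: N_def sum_nonneg_eq_0_iff finite_V nonneg_y_hat)
    \<comment> \<open>Both functions are \<open>undefined\<close> off the vertex set, so agreement
      on the vertices is equality.\<close>
    then have "y_hat = (\<lambda>v\<in>?V. 0)"
      using assms(6) by (auto simp: fun_eq_iff)
    with assms(7) show False
      by contradiction
  qed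
  moreover have "0 \<le> N"
    by (simp add: N_def sum_nonneg nonneg_y_hat)
  ultimately have N: "0 < N"
    by simp
  have y: "y = (\<lambda>v\<in>?V. y_hat v / N)"
    by (simp add: assms(8) norm)
  have "(\<Sum>v\<in>?V. y v) = 1"
    using N by (simp add: y sum_divide_distrib[symmetric] N_def[symmetric])
  then have "ranking_vector ?V y"
    using N by (simp add: rv y nonneg_y_hat)
  moreover have "(1 - \<epsilon>) * (\<Sum>u\<in>?V. y u * ?M u v) \<le> y v" if v: "v \<in> ?V" for v
  proof -
    \<comment> \<open>Both sides of \<open>sub\<close> are linear in the vector, so division by
      \<open>N\<close> carries the inequality over to \<open>y\<close>.\<close>
    have "(1 - \<epsilon>) * (\<Sum>u\<in>?V. y u * ?M u v) = (1 - \<epsilon>) * (\<Sum>u\<in>?V. y_hat u * ?M u v) / N"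
      by (simp add: y sum_divide_distrib[symmetric])
    also have "\<dots> \<le> y_hat v / N"
      using sub[OF v] N by (intro divide_right_mono) simp_all
    finally show ?thesis
      using v by (simp add: y)
  qed
  ultimately show ?thesis
    by (simp add: pv)
qed

end
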